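(* Let $n,p$ be positive integers and suppose that $l:(S^{p-1})^n\to\mathbb{R}_{\ge 0}$, $l(v_1,\dots,v_n)=\max_{\delta\in\{-1,1\}^n}\left\|\sum_{i=1}^n\delta_iv_i\right\|^2$, attains a local minimum at $\underline{v}=(v_1,\dots,v_n)$. Then there exist real numbers $c^i_\alpha$, for $1\le i\le n$ and $\alpha\in M_{\underline{v}}$, such that for every $1\le i\le n$ the vector $(c^i_\alpha)_{\alpha\in M_{\underline{v}}}\in\mathbb{R}^{|M_{\underline{v}}|}$ is nonzero and $\sum_{\alpha\in M_{\underline{v}}}c^i_\alpha V_\alpha\in\mathbb{R}^p$ is a scalar multiple of $v_i$.
   Context: $S^{p-1}=\{v\in\mathbb{R}^p:\|v\|=1\}$ with the Euclidean norm. The function $l$ attains a local minimum at $\underline{v}$ if $l(\underline{v})$ is the minimal value of $l$ on some neighborhood of $\underline{v}$ in $(S^{p-1})^n$. For fixed $\underline{v}\in(S^{p-1})^n$ and $\alpha=(\alpha_1,\dots,\alpha_n)\in\{\pm1\}^n$, put $V_\alpha=\sum_{i=1}^n\alpha_iv_i$. Let $\pm M_{\underline{v}}=\{\beta\in\{\pm1\}^n:\|V_\beta\|^2=l(\underline{v})\}$, which is invariant under $\alpha\mapsto-\alpha$. Let $M_{\underline{v}}\subset\pm M_{\underline{v}}$ be a chosen subset with $\pm M_{\underline{v}}=M_{\underline{v}}\cup(-M_{\underline{v}})$ and $M_{\underline{v}}\cap(-M_{\underline{v}})=\emptyset$, where $-M_{\underline{v}}=\{\alpha\in\{\pm1\}^n:-\alpha\in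 M_{\underline{v}}\}$ (i.e. one representative from each antipodal pair). *)

theory Defs
  imports "HOL-Analysis.Analysis"
begin

text \<open>
  An \<open>n\<close>-tuple of vectors in \<open>p\<close>-dimensional Euclidean space is an element of \<^typ>\<open>real^'p^'n\<close>,
  whose topology is the product topology.  Index types are finite and nonempty, so
  \<open>n, p \<ge> 1\<close> is automatic.
\<close>

definition sphere_tuples :: "(real^'p^'n) set" where
  "sphere_tuples = {v. \<forall>i. v $ i \<in> sphere 0 1}"

definition sign_vectors :: "(real^'n) set" where
  "sign_vectors = {\<alpha>. \<forall>i. \<alpha> $ i \<in> {-1, 1}}"

definition signed_sum :: "real^'p^'n \<Rightarrow> real^'n \<Rightarrow> real^'p" where
  "signed_sum v \<alpha> = (\<Sum>i\<in>UNIV. (\<alpha> $ i) *\<^sub>R (v $ i))"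

lemma finite_sign_vectors: "finite (sign_vectors :: (real^'n) set)"
proof -
  have "sign_vectors \<subseteq> (vec_lambda ` (UNIV \<rightarrow>\<^sub>E {-1, 1}) :: (real^'n) set)"
  proof
    fix \<alpha> :: "real^'n"
    assume "\<alpha> \<in> sign_vectors"
    then have "vec_nth \<alpha> \<in> UNIV \<rightarrow>\<^sub>E {-1, 1}"
      by (auto simp: sign_vectors_def PiE_def Pi_def)
    then have "vec_lambda (vec_nth \<alpha>) \<in> vec_lambda ` (UNIV \<rightarrow>\<^sub>E {-1, 1::real})"
      by (rule imageI)
    then show "\<alpha> \<in> vec_lambda ` (UNIV \<rightarrow>\<^sub>E {-1, 1})"
      by simp
  qed
  then show ?thesis
    by (rule finite_subset) (intro finite_imageI finite_PiE; simp)
qed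

lemma sign_vectors_nonempty: "(sign_vectors :: (real^'n) set) \<noteq> {}"
proof -
  have "(\<chi> i. 1) \<in> (sign_vectors :: (real^'n) set)"
    by (simp add: sign_vectors_def)
  then show ?thesis by blast
qed

definition max_signed_sum :: "real^'p^'n \<Rightarrow> real" where
  "max_signed_sum v = Max ((\<lambda>\<delta>. (norm (signed_sum v \<delta>))\<^sup>2) ` sign_vectors)"

definition attains_local_min_on ::
    "('a::topological_space \<Rightarrow> real) \<Rightarrow> 'a set \<Rightarrow> 'a \<Rightarrow> bool" where
  "attains_local_min_on f S x \<longleftrightarrow>
     x \<in> S \<and> (\<exists>U. open U \<and> x \<in> U \<and> (\<forall>y \<in> U \<inter> S. f x \<le> f y))"

definition pm_maximizers :: "real^'p^'n \<Rightarrow> (real^'n) set" where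
  "pm_maximizers v =
     {\<beta> \<in> sign_vectors. (norm (signed_sum v \<beta>))\<^sup>2 = max_signed_sum v}"

definition antipodal :: "(real^'n) set \<Rightarrow> (real^'n) set" where
  "antipodal M = {\<alpha> \<in> sign_vectors. - \<alpha> \<in> M}"

definition antipodal_representatives :: "real^'p^'n \<Rightarrow> (real^'n) set \<Rightarrow> bool" where
  "antipodal_representatives v M \<longleftrightarrow>
     M \<subseteq> pm_maximizers v \<and> pm_maximizers v = M \<union> antipodal M \<and> M \<inter> antipodal M = {}"

end

theory Submission
  imports Defs
begin

text \<open>
  Only one of the vectors has to move. Rotate \<open>v\<^sub>i\<close> along the great circle
  \<open>cos t v\<^sub>i + sin t w\<close> with \<open>w\<close> a unit vector orthogonal to \<open>v\<^sub>i\<close>. The derivative of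
  \<open>\<parallel>V\<^sub>\<alpha>\<parallel>\<^sup>2\<close> at \<open>t = 0\<close> is \<open>2 w \<bullet> (\<alpha>\<^sub>i V\<^sub>\<alpha>)\<close>. If this were negative for
  every maximizing \<open>\<alpha>\<close>, then for small \<open>t > 0\<close> all these values would fall below the old maximum,
  while the finitely many other sign vectors stay below it by continuity; this contradicts local
  minimality (\<open>local_min_tangent_direction\<close>). As \<open>\<alpha>\<^sub>i V\<^sub>\<alpha>\<close> does not change under
  \<open>\<alpha> \<mapsto> -\<alpha>\<close>, it is enough to look at one representative of each antipodal pair.

  So no tangent direction at \<open>v\<^sub>i\<close> makes a negative inner product with all the vectors
  \<open>\<alpha>\<^sub>i V\<^sub>\<alpha>\<close>. By hyperplane separation, applied to their projections to the orthogonal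
  complement of \<open>v\<^sub>i\<close>, the origin is a convex combination of these projections
  (\<open>convex_combination_parallel\<close>). The weights sum to 1, hence do not all vanish, and
  multiplied by the signs \<open>\<alpha>\<^sub>i\<close> they are the required coefficients.
\<close>

text \<open>
  For a non-injective family the convex weights on the image set have to be moved back to the index
  set; they are put on one index of each fibre.
\<close>

lemma convex_hull_image_weights:
  fixes g :: "'a \<Rightarrow> 'b::real_vector"
  assumes "finite A" and "x \<in> convex hull (g ` A)"
  obtains u where "\<And>a. a \<in> A \<Longrightarrow> 0 \<le> u a" "sum u A = 1" "(\<Sum>a\<in>A. u a *\<^sub>R g a) = x"
proof -
  obtain B where B: "B \<subseteq> A" "inj_on g B" "g ` A = g ` B"
    using subset_image_inj[of "g ` A" g A] by auto
  have "finite (g ` B)"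
    using assms(1) B(1) by (meson finite_imageI finite_subset)
  then obtain w where w: "\<forall>y\<in>g ` B. 0 \<le> w y" "sum w (g ` B) = 1"
      "(\<Sum>y\<in>g ` B. w y *\<^sub>R y) = x"
    using assms(2) unfolding B(3) by (auto simp: convex_hull_finite)
  define u where "u a = (if a \<in> B then w (g a) else 0)" for a
  have "sum u A = sum u B" "(\<Sum>a\<in>A. u a *\<^sub>R g a) = (\<Sum>a\<in>B. u a *\<^sub>R g a)"
    using assms(1) B(1) by (intro sum.mono_neutral_right; simp add: u_def)+
  moreover have "sum u B = 1"
    using w(2) by (simp add: sum.reindex[OF B(2)] u_def)
  moreover have "(\<Sum>a\<in>B. u a *\<^sub>R g a) = x"
    using w(3) by (simp add: sum.reindex[OF B(2)] u_def)
  ultimately show ?thesis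
    using w(1) that[of u] by (auto simp: u_def)
qed

text \<open>
  A theorem of the alternative of Gordan type, relative to the orthogonal complement of \<open>e\<close>:
  otherwise a hyperplane strictly separates the origin from the convex hull of the projected
  vectors, and the projection of its normal violates the hypothesis.
\<close>

lemma convex_combination_parallel:
  fixes g :: "'a \<Rightarrow> 'b::euclidean_space"
  assumes "finite A" "A \<noteq> {}" and e: "norm e = 1"
    and dir: "\<And>w. norm w = 1 \<Longrightarrow> w \<bullet> e = 0 \<Longrightarrow> \<exists>a\<in>A. 0 \<le> w \<bullet> g a"
  obtains u t where "\<And>a. a \<in> A \<Longrightarrow> 0 \<le> u a" "sum u A = 1" "(\<Sum>a\<in>A. u a *\<^sub>R g a) = t *\<^sub>R e"
proof -
  define P where "P x = x - (x \<bullet> e) *\<^sub>R e" for x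
  let ?S = "convex hull ((\<lambda>a. P (g a)) ` A)"
  have ee: "e \<bullet> e = 1"
    using e by (simp add: norm_eq_1)
  have "0 \<in> ?S"
  proof (rule ccontr)
    assume "0 \<notin> ?S"
    moreover have "closed ?S"
      using assms(1) by (simp add: compact_imp_closed finite_imp_compact_convex_hull)
    ultimately obtain n b where nb: "0 < b" "\<forall>x\<in>?S. b < n \<bullet> x"
      using separating_hyperplane_closed_0[of ?S] by (auto simp: convex_convex_hull)
    have pos: "0 < n \<bullet> P (g a)" if "a \<in> A" for a
      using nb that by (meson hull_inc imageI less_trans)
    have sym: "P n \<bullet> x = n \<bullet> P x" for x
      by (simp add: P_def inner_diff_left inner_diff_right inner_commute)
    have orth: "P n \<bullet> e = 0"
      by (simp add: P_def inner_diff_left ee)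
    \<comment> \<open>The normal points towards the hull, so the unit vector to test is opposite to its projection.\<close>
    have "P n \<noteq> 0"
      using assms(2) pos sym by (metis all_not_in_conv inner_zero_left less_irrefl)
    then have "norm (- sgn (P n)) = 1"
      by (simp add: norm_sgn)
    moreover have "- sgn (P n) \<bullet> e = 0"
      by (simp add: sgn_div_norm orth)
    ultimately obtain a where "a \<in> A" "0 \<le> - sgn (P n) \<bullet> g a"
      using dir by blast
    moreover have "0 < sgn (P n) \<bullet> g a"
      using pos[OF \<open>a \<in> A\<close>] \<open>P n \<noteq> 0\<close> by (simp add: sgn_div_norm sym)
    ultimately show False
      by simp
  qed
  then obtain u where u: "\<And>a. a \<in> A \<Longrightarrow> 0 \<le> u a" "sum u A = 1"
      "(\<Sum>a\<in>A. u a *\<^sub>R P (g a)) = 0"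
    using convex_hull_image_weights[OF assms(1)] by metis
  have "(\<Sum>a\<in>A. u a *\<^sub>R g a) = (\<Sum>a\<in>A. u a * (g a \<bullet> e)) *\<^sub>R e"
    using u(3) by (simp add: P_def scaleR_diff_right sum_subtractf scaleR_sum_left)
  then show ?thesis
    using u that by blast
qed

definition rotate_component :: "real^'p^'n \<Rightarrow> 'n \<Rightarrow> real^'p \<Rightarrow> real \<Rightarrow> real^'p^'n" where
  "rotate_component v i w t = (\<chi> j. if j = i then cos t *\<^sub>R (v $ i) + sin t *\<^sub>R w else v $ j)"

lemma rotate_component_0: "rotate_component v i w 0 = v"
  by (simp add: rotate_component_def vec_eq_iff)

lemma rotate_component_in_sphere_tuples:
  assumes "v \<in> sphere_tuples" "norm w = 1" "w \<bullet> (v $ i) = 0"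
  shows "rotate_component v i w t \<in> sphere_tuples"
proof -
  have "norm (v $ j) = 1" for j
    using assms(1) by (simp add: sphere_tuples_def)
  moreover from this have "norm (cos t *\<^sub>R (v $ i) + sin t *\<^sub>R w) = 1"
    using assms(2,3)
    by (simp add: norm_eq_1 inner_add_left inner_add_right inner_commute
        flip: power2_eq_square)
  ultimately show ?thesis
    by (simp add: sphere_tuples_def rotate_component_def)
qed

lemma tendsto_rotate_component: "(rotate_component v i w \<longlongrightarrow> v) (at 0)"
proof -
  have "((\<lambda>t. rotate_component v i w t $ j) \<longlongrightarrow> v $ j) (at 0)" for j
    unfolding rotate_component_def by (cases "j = i") (auto intro!: tendsto_eq_intros)
  then show ?thesis
    by (rule vec_tendstoI)
qed

lemma signed_sum_rotate_component:
  "signed_sum (rotate_component v i w t) \<alpha> =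
     signed_sum v \<alpha> + (\<alpha> $ i) *\<^sub>R ((cos t - 1) *\<^sub>R (v $ i) + sin t *\<^sub>R w)"
proof -
  have "signed_sum (rotate_component v i w t) \<alpha> - signed_sum v \<alpha> =
      (\<Sum>j\<in>UNIV. if j = i then (\<alpha> $ i) *\<^sub>R ((cos t - 1) *\<^sub>R (v $ i) + sin t *\<^sub>R w) else 0)"
    unfolding signed_sum_def sum_subtractf[symmetric]
    by (rule sum.cong) (auto simp: rotate_component_def algebra_simps)
  then show ?thesis
    by (simp add: algebra_simps)
qed

lemma signed_sum_uminus: "signed_sum v (- \<alpha>) = - signed_sum v \<alpha>"
  by (simp add: signed_sum_def sum_negf)

text \<open>
  The displacement of \<open>V\<^sub>\<alpha>\<close> is \<open>\<alpha>\<^sub>i ((cos t - 1) v\<^sub>i + sin t w)\<close>. Its component along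
  \<open>v\<^sub>i\<close> is of second order in \<open>t\<close>, so only \<open>w\<close> enters the derivative.
\<close>

lemma DERIV_norm_signed_sum_rotate:
  "((\<lambda>t. (norm (signed_sum (rotate_component v i w t) \<alpha>))\<^sup>2) has_real_derivative
      2 * (w \<bullet> (\<alpha> $ i *\<^sub>R signed_sum v \<alpha>))) (at 0)"
  unfolding signed_sum_rotate_component power2_norm_eq_inner inner_add_left inner_add_right
    inner_scaleR_left inner_scaleR_right
  by (auto intro!: derivative_eq_intros simp: inner_commute)

lemma norm_signed_sum_le_max:
  assumes "\<alpha> \<in> sign_vectors"
  shows "(norm (signed_sum v \<alpha>))\<^sup>2 \<le> max_signed_sum v"
  unfolding max_signed_sum_def using assms by (intro Max_ge) (auto simp: finite_sign_vectors)

lemma max_signed_sum_less_iff: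
  "max_signed_sum v < x \<longleftrightarrow> (\<forall>\<alpha>\<in>sign_vectors. (norm (signed_sum v \<alpha>))\<^sup>2 < x)"
  unfolding max_signed_sum_def
  by (subst Max_less_iff) (auto simp: finite_sign_vectors sign_vectors_nonempty)

lemma pm_maximizers_nonempty: "pm_maximizers v \<noteq> {}"
  using max_signed_sum_less_iff[of v "max_signed_sum v"] norm_signed_sum_le_max[of _ v]
  by (force simp: pm_maximizers_def)

text \<open>
  First-order necessary condition. Since there are finitely many sign vectors, one interval of
  small \<open>t > 0\<close> serves for all of them: maximizers decrease strictly by the sign of their
  derivative, and non-maximizers have a gap to the maximum.
\<close>

lemma local_min_tangent_direction:
  fixes v :: "real^'p^'n"
  assumes "attains_local_min_on max_signed_sum sphere_tuples v"
    and w: "norm w = 1" "w \<bullet> (v $ i) = 0"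
  shows "\<exists>\<alpha>\<in>pm_maximizers v. 0 \<le> w \<bullet> (\<alpha> $ i *\<^sub>R signed_sum v \<alpha>)"
proof (rule ccontr)
  assume "\<not> ?thesis"
  then have neg: "w \<bullet> (\<alpha> $ i *\<^sub>R signed_sum v \<alpha>) < 0" if "\<alpha> \<in> pm_maximizers v" for \<alpha>
    using that by force
  obtain U where v: "v \<in> sphere_tuples" and U: "open U" "v \<in> U"
      "\<And>y. y \<in> U \<Longrightarrow> y \<in> sphere_tuples \<Longrightarrow> max_signed_sum v \<le> max_signed_sum y"
    using assms(1) by (auto simp: attains_local_min_on_def)
  let ?r = "rotate_component v i w"
  let ?f = "\<lambda>\<alpha> t. (norm (signed_sum (?r t) \<alpha>))\<^sup>2"
  have "\<forall>\<^sub>F t in at_right 0. ?f \<alpha> t < max_signed_sum v" if \<alpha>: "\<alpha> \<in> sign_vectors" for \<alpha>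
  proof (cases "\<alpha> \<in> pm_maximizers v")
    case True
    then have "?f \<alpha> 0 = max_signed_sum v"
      by (simp add: rotate_component_0 pm_maximizers_def)
    moreover obtain d where "0 < d" "\<forall>h>0. h < d \<longrightarrow> ?f \<alpha> (0 + h) < ?f \<alpha> 0"
      using DERIV_neg_dec_right[OF DERIV_norm_signed_sum_rotate[of v i w \<alpha>]] neg[OF True] by auto
    ultimately show ?thesis
      by (auto simp: eventually_at_right_field)
  next
    case False
    then have "?f \<alpha> 0 < max_signed_sum v"
      using \<alpha> norm_signed_sum_le_max[OF \<alpha>, of v]
      by (simp add: rotate_component_0 pm_maximizers_def)
    moreover have "(?f \<alpha> \<longlongrightarrow> ?f \<alpha> 0) (at_right 0)"
      using DERIV_isCont[OF DERIV_norm_signed_sum_rotate[of v i w \<alpha>]]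
      by (simp add: isCont_def filterlim_at_split)
    ultimately show ?thesis
      by (rule order_tendstoD(2)[rotated])
  qed
  then have "\<forall>\<^sub>F t in at_right 0. max_signed_sum (?r t) < max_signed_sum v"
    by (simp add: max_signed_sum_less_iff eventually_ball_finite finite_sign_vectors)
  moreover have "\<forall>\<^sub>F t in at_right 0. ?r t \<in> U"
    using topological_tendstoD[OF tendsto_rotate_component U(1,2)]
    by (simp add: eventually_at_split)
  ultimately have "\<forall>\<^sub>F t in at_right (0::real). False"
    by eventually_elim
      (use U(3) rotate_component_in_sphere_tuples[OF v w] in \<open>force simp: not_less\<close>)
  then show False
    by simp
qed

theorem lemma2p5:
  fixes v :: "real^'p^'n" and M :: "(real^'n) set"
  assumes "attains_local_min_on max_signed_sum sphere_tuples v"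
    and "antipodal_representatives v M"
  shows "\<exists>c :: 'n \<Rightarrow> real^'n \<Rightarrow> real.
           \<forall>i. (\<exists>\<alpha>\<in>M. c i \<alpha> \<noteq> 0) \<and>
               (\<exists>t::real. (\<Sum>\<alpha>\<in>M. c i \<alpha> *\<^sub>R signed_sum v \<alpha>) = t *\<^sub>R (v $ i))"
proof -
  have M: "M \<subseteq> sign_vectors" "pm_maximizers v = M \<union> antipodal M"
    using assms(2) by (auto simp: antipodal_representatives_def pm_maximizers_def)
  have "finite M"
    using M(1) finite_sign_vectors by (rule finite_subset)
  have "M \<noteq> {}"
    using pm_maximizers_nonempty[of v] M(2) by (auto simp: antipodal_def)
  have "\<exists>c. (\<exists>\<alpha>\<in>M. c \<alpha> \<noteq> 0) \<and>
      (\<exists>t. (\<Sum>\<alpha>\<in>M. c \<alpha> *\<^sub>R signed_sum v \<alpha>) = t *\<^sub>R (v $ i))" for i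
  proof -
    have "norm (v $ i) = 1"
      using assms(1) by (simp add: attains_local_min_on_def sphere_tuples_def)
    moreover have "\<exists>\<alpha>\<in>M. 0 \<le> w \<bullet> (\<alpha> $ i *\<^sub>R signed_sum v \<alpha>)"
      if w: "norm w = 1" "w \<bullet> (v $ i) = 0" for w
    proof -
      obtain \<alpha> where \<alpha>: "\<alpha> \<in> M \<union> antipodal M" "0 \<le> w \<bullet> (\<alpha> $ i *\<^sub>R signed_sum v \<alpha>)"
        using local_min_tangent_direction[OF assms(1) w] M(2) by auto
      have "(- \<alpha>) $ i *\<^sub>R signed_sum v (- \<alpha>) = \<alpha> $ i *\<^sub>R signed_sum v \<alpha>"
        by (simp add: signed_sum_uminus)
      with \<alpha> show ?thesis
        unfolding antipodal_def by (metis (mono_tags, lifting) Un_iff mem_Collect_eq)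
    qed
    ultimately obtain u t where u: "sum u M = 1"
        "(\<Sum>\<alpha>\<in>M. u \<alpha> *\<^sub>R (\<alpha> $ i *\<^sub>R signed_sum v \<alpha>)) = t *\<^sub>R (v $ i)"
      using convex_combination_parallel[OF \<open>finite M\<close> \<open>M \<noteq> {}\<close>,
          of "v $ i" "\<lambda>\<alpha>. \<alpha> $ i *\<^sub>R signed_sum v \<alpha>"] by blast
    obtain \<alpha> where "\<alpha> \<in> M" "u \<alpha> \<noteq> 0"
      using u(1) by (metis sum.neutral zero_neq_one)
    moreover have "\<alpha> $ i \<noteq> 0"
      using \<open>\<alpha> \<in> M\<close> M(1) unfolding sign_vectors_def
      by (metis (mono_tags, lifting) in_mono insert_iff mem_Collect_eq neg_equal_0_iff_equal
          singletonD zero_neq_one)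
    ultimately show ?thesis
      using u(2) by (intro exI[of _ "\<lambda>\<alpha>. u \<alpha> * \<alpha> $ i"]) auto
  qed
  then show ?thesis
    by metis
qed

end
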